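(* Let $A_1A_2A_3A_4$ be a fundamental tetrahedron (with vertices in $\widehat{\mathbb{Q}}(\sigma)$), let $X\in\widehat{\mathbb{Q}}(\sigma)$ be distinct from $A_1,\dots,A_4$, and let $l_i=l(X,A_i)$ be the det-length, $i=1,\dots,4$. Then $$\sum_{i=1}^4 l_i^4=\sum_{1\le i<j\le4}l_i^2l_j^2.$$
   Context: Let $\sigma=e^{i\pi/3}=\frac{1+i\sqrt3}{2}$, $\mathbb{Z}[\sigma]$ the Eisenstein integers, $\mathbb{Q}(\sigma)$ its fraction field, $\widehat{\mathbb{Q}}(\sigma)=\mathbb{Q}(\sigma)\cup\{\infty\}$. In the upper half-space model of $\mathbb{H}^3$ (boundary $\widehat{\mathbb{C}}$), let $T$ be the regular ideal tetrahedron with vertices $0,1,\sigma,\infty$ and $H$ the group generated by reflections in the faces of $T$; the images $hT$, $h\in H$, are the fundamental tetrahedra, which tile $\mathbb{H}^3$ with vertex set $\widehat{\mathbb{Q}}(\sigma)$. A fraction $p/q$ ($p,q\in\mathbb{Z}[\sigma]$, not both zero, $p/0=\infty$) is irreducible if every common factor $k\in\mathbb{Z}[\sigma]$ of $p,q$ has $|k|=1$; each point of $\widehat{\mathbb{Q}}(\sigma)$ has an irreducible representation, unique up to a common unit factor. For points represented by irreducible fractions $p_1/q_1$, $p_2/q_2$, the det-length is $l(p_1/q_1,p_2/q_2)=|p_1q_2-p_2q_1|$. *)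

theory Defs
  imports "HOL-Analysis.Analysis" "HOL-Algebra.Generated_Groups" "HOL-Algebra.Bij"
begin

definition eis :: complex where
  "eis = cis (pi / 3)"

definition eis_ints :: "complex set" where
  "eis_ints = {of_int a + of_int b * eis | a b. True}"

definition eis_field :: "complex set" where
  "eis_field = {p / q | p q. p \<in> eis_ints \<and> q \<in> eis_ints \<and> q \<noteq> 0}"

text \<open>One-point compactifications are rendered by the type \<open>option\<close>, with \<^const>\<open>None\<close> as the
  point at infinity. In particular \<open>complex option\<close> is the
  Riemann sphere.\<close>

definition eis_field_hat :: "complex option set" where
  "eis_field_hat = insert None (Some ` eis_field)"

definition frac_point :: "complex \<Rightarrow> complex \<Rightarrow> complex option" where
  "frac_point p q = (if q = 0 then None else Some (p / q))"

definition eis_dvd :: "complex \<Rightarrow> complex \<Rightarrow> bool" where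
  "eis_dvd k p \<longleftrightarrow> (\<exists>m\<in>eis_ints. p = k * m)"

definition irreducible_frac :: "complex \<Rightarrow> complex \<Rightarrow> bool" where
  "irreducible_frac p q \<longleftrightarrow>
     p \<in> eis_ints \<and> q \<in> eis_ints \<and> \<not> (p = 0 \<and> q = 0) \<and>
     (\<forall>k\<in>eis_ints. eis_dvd k p \<and> eis_dvd k q \<longrightarrow> cmod k = 1)"

text \<open>The description is meaningful for points of \<^const>\<open>eis_field_hat\<close> only: these have an
  irreducible representation, unique up to a common unit factor, so that the modulus below does
  not depend on the choice.\<close>

definition det_length :: "complex option \<Rightarrow> complex option \<Rightarrow> real" where
  "det_length x y = (THE l. \<exists>p1 q1 p2 q2.
     irreducible_frac p1 q1 \<and> x = frac_point p1 q1 \<and>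
     irreducible_frac p2 q2 \<and> y = frac_point p2 q2 \<and>
     l = cmod (p1 * q2 - p2 * q1))"

text \<open>The upper half-space is the set of \<open>(z, t) :: complex \<times> real\<close> with \<open>t > 0\<close>; together with its
  boundary it sits inside the compactification \<open>(complex \<times> real) option\<close> of Euclidean 3-space.\<close>

definition ideal_point :: "complex option \<Rightarrow> (complex \<times> real) option" where
  "ideal_point = map_option (\<lambda>z. (z, 0))"

definition sphere_inversion ::
    "'a::real_normed_vector \<Rightarrow> real \<Rightarrow> 'a option \<Rightarrow> 'a option" where
  "sphere_inversion c r x = (case x of
       None \<Rightarrow> Some c
     | Some v \<Rightarrow> if v = c then None else Some (c + (r\<^sup>2 / (norm (v - c))\<^sup>2) *\<^sub>R (v - c)))"

definition plane_reflection ::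
    "'a::real_inner \<Rightarrow> real \<Rightarrow> 'a option \<Rightarrow> 'a option" where
  "plane_reflection n b = map_option (\<lambda>v. v - (2 * (n \<bullet> v - b) / (n \<bullet> n)) *\<^sub>R n)"

text \<open>\<open>hyp_reflection P \<rho>\<close>: \<open>\<rho>\<close> is the reflection of hyperbolic 3-space, extended to the boundary, in
  the hyperbolic plane whose closure is \<open>P\<close>. Hyperbolic planes are the hemispheres centred on the
  boundary and the vertical Euclidean half-planes.\<close>

inductive hyp_reflection ::
    "(complex \<times> real) option set \<Rightarrow> ((complex \<times> real) option \<Rightarrow> (complex \<times> real) option) \<Rightarrow> bool"
where
  hemisphere: "r > 0 \<Longrightarrow>
    hyp_reflection (Some ` {v \<in> sphere (c, 0) r. snd v \<ge> 0}) (sphere_inversion (c, 0) r)"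
| vertical: "n \<noteq> 0 \<Longrightarrow>
    hyp_reflection (insert None (Some ` {v. (n, 0) \<bullet> v = b \<and> snd v \<ge> 0})) (plane_reflection (n, 0) b)"

text \<open>An ideal tetrahedron is given by the set of its four ideal vertices. A face is opposite to a
  vertex \<open>v\<close>, and is contained in the unique hyperbolic plane whose closure contains the other three
  vertices.\<close>

definition base_vertices :: "(complex \<times> real) option set" where
  "base_vertices = ideal_point ` {Some 0, Some 1, Some eis, None}"

definition face_reflections :: "((complex \<times> real) option \<Rightarrow> (complex \<times> real) option) set" where
  "face_reflections = {\<rho>. \<exists>v\<in>base_vertices. \<exists>P. base_vertices - {v} \<subseteq> P \<and> hyp_reflection P \<rho>}"

definition reflection_group :: "((complex \<times> real) option \<Rightarrow> (complex \<times> real) option) set" where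
  "reflection_group = generate (BijGroup UNIV) face_reflections"

definition fundamental_tetrahedron :: "complex option set \<Rightarrow> bool" where
  "fundamental_tetrahedron V \<longleftrightarrow> (\<exists>h\<in>reflection_group. ideal_point ` V = h ` base_vertices)"

end

theory Submission
  imports Defs
begin

text \<open>Every element of the reflection group acts on homogeneous coordinates of boundary points by a
  matrix over the Eisenstein integers with unit determinant, possibly after complex conjugation.
  Such a map carries irreducible fractions to irreducible fractions. Hence, if \<open>\<alpha>\<close> and \<open>\<beta>\<close> are the
  determinants of \<open>X\<close> with the images of \<open>(1, 0)\<close> and \<open>(0, 1)\<close>, the four det-lengths are
  \<open>\<bar>\<beta>\<bar>, \<bar>\<alpha> + \<beta>\<bar>, \<bar>s \<alpha> + \<beta>\<bar>, \<bar>\<alpha>\<bar>\<close> with \<open>s\<close> equal to \<open>\<sigma>\<close> or its conjugate, and the claim becomes a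
  polynomial identity in the real and imaginary parts of \<open>\<alpha>\<close> and \<open>\<beta>\<close>.\<close>

section \<open>Eisenstein integers\<close>

lemma eis_Complex: "eis = Complex (1 / 2) (sqrt 3 / 2)"
  by (simp add: eis_def cis.code cos_60 sin_60)

lemma Re_eis [simp]: "Re eis = 1 / 2" and Im_eis [simp]: "Im eis = sqrt 3 / 2"
  by (simp_all add: eis_Complex)

lemma cmod_eis [simp]: "cmod eis = 1"
  by (simp add: eis_def)

lemma eis_neq [simp]: "eis \<noteq> 0" "eis \<noteq> 1"
  by (simp_all add: complex_eq_iff)

lemma eis_squared: "eis * eis = eis - 1"
  by (simp add: complex_eq_iff)

lemma cnj_eis: "cnj eis = 1 - eis"
  by (simp add: complex_eq_iff)

lemma of_int_in_eis_ints [simp, intro]: "of_int a \<in> eis_ints"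
  unfolding eis_ints_def by (rule CollectI, rule exI[of _ a], rule exI[of _ 0]) simp

lemma eis_ints_01 [simp, intro]: "0 \<in> eis_ints" "1 \<in> eis_ints"
  using of_int_in_eis_ints[of 0] of_int_in_eis_ints[of 1] by simp_all

lemma eis_in_eis_ints [simp, intro]: "eis \<in> eis_ints"
  unfolding eis_ints_def by (rule CollectI, rule exI[of _ 0], rule exI[of _ 1]) simp

lemma eis_ints_add [simp, intro]: "x \<in> eis_ints \<Longrightarrow> y \<in> eis_ints \<Longrightarrow> x + y \<in> eis_ints"
proof -
  assume "x \<in> eis_ints" "y \<in> eis_ints"
  then obtain a b c d where "x = of_int a + of_int b * eis" "y = of_int c + of_int d * eis"
    by (auto simp: eis_ints_def)
  then have "x + y = of_int (a + c) + of_int (b + d) * eis"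
    by (simp add: algebra_simps)
  then show ?thesis unfolding eis_ints_def by blast
qed

lemma eis_ints_mult [simp, intro]: "x \<in> eis_ints \<Longrightarrow> y \<in> eis_ints \<Longrightarrow> x * y \<in> eis_ints"
proof -
  assume "x \<in> eis_ints" "y \<in> eis_ints"
  then obtain a b c d where "x = of_int a + of_int b * eis" "y = of_int c + of_int d * eis"
    by (auto simp: eis_ints_def)
  then have "x * y = of_int a * of_int c + (of_int a * of_int d + of_int b * of_int c) * eis
      + of_int b * of_int d * (eis * eis)"
    by (simp add: algebra_simps)
  also have "\<dots> = of_int (a * c - b * d) + of_int (a * d + b * c + b * d) * eis"
    by (simp add: eis_squared algebra_simps)
  finally show ?thesis unfolding eis_ints_def by blast
qed

lemma eis_ints_uminus [simp, intro]: "x \<in> eis_ints \<Longrightarrow> - x \<in> eis_ints"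
  using eis_ints_mult[of "-1" x] of_int_in_eis_ints[of "-1"] by simp

lemma eis_ints_diff [simp, intro]: "x \<in> eis_ints \<Longrightarrow> y \<in> eis_ints \<Longrightarrow> x - y \<in> eis_ints"
  using eis_ints_add[of x "- y"] by simp

lemma eis_ints_cnj [simp, intro]: "x \<in> eis_ints \<Longrightarrow> cnj x \<in> eis_ints"
  by (subst (asm) eis_ints_def) (auto simp: cnj_eis)

section \<open>The norm form and Euclidean division\<close>

text \<open>Real coordinates are allowed because the formula serves twice: for norms of Eisenstein
  integers and for the size of a rounding error.\<close>

lemma cmod_eis_coords: "(cmod (of_real u + of_real v * eis))\<^sup>2 = u\<^sup>2 + u * v + v\<^sup>2"
proof -
  have "(sqrt 3 * v / 2)\<^sup>2 = 3 * v\<^sup>2 / 4"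
    by (simp add: power_mult_distrib power_divide)
  then show ?thesis
    unfolding cmod_power2 by (simp add: power2_eq_square field_simps)
qed

text \<open>The norm form has integer values at integer coordinates. This makes the squared modulus
  a natural-number measure by which least elements can be chosen.\<close>

lemma eis_ints_norm_nat:
  assumes "x \<in> eis_ints"
  shows "real (nat \<lfloor>(cmod x)\<^sup>2\<rfloor>) = (cmod x)\<^sup>2"
proof -
  obtain a b where x: "x = of_int a + of_int b * eis"
    using assms by (auto simp: eis_ints_def)
  define n where "n = a\<^sup>2 + a * b + b\<^sup>2"
  have n: "(cmod x)\<^sup>2 = of_int n"
    using cmod_eis_coords[of "of_int a" "of_int b"] by (simp add: x n_def)
  then have "0 \<le> n" by (metis of_int_0_le_iff zero_le_power2)
  then show ?thesis by (simp add: n)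
qed

lemma eis_ints_cmod_ge_1:
  assumes "x \<in> eis_ints" "x \<noteq> 0"
  shows "1 \<le> cmod x"
proof -
  have "0 < (cmod x)\<^sup>2" using assms by simp
  then have "1 \<le> nat \<lfloor>(cmod x)\<^sup>2\<rfloor>"
    by (subst (asm) eis_ints_norm_nat[OF assms(1), symmetric]) linarith
  then have "1 \<le> (cmod x)\<^sup>2"
    by (subst eis_ints_norm_nat[OF assms(1), symmetric]) linarith
  then show ?thesis by (simp add: power2_nonneg_ge_1_iff)
qed

text \<open>Both factors are nonzero, hence of modulus at least 1, so neither can exceed 1.\<close>

lemma eis_ints_unit:
  assumes "x \<in> eis_ints" "y \<in> eis_ints" "cmod (x * y) = 1"
  shows "cmod x = 1"
proof -
  have "1 \<le> cmod x" "1 \<le> cmod y"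
    using assms by (auto intro!: eis_ints_cmod_ge_1)
  moreover have "cmod x * cmod y = 1" using assms by (simp add: norm_mult)
  moreover have "cmod x * 1 \<le> cmod x * cmod y"
    using calculation by (intro mult_left_mono) auto
  ultimately show ?thesis by simp
qed

text \<open>Rounding both coordinates in the basis 1, \<open>eis\<close> leaves errors of at most
  1/2, and the norm form is then at most 3/4. This is what makes the Eisenstein integers
  Euclidean.\<close>

lemma eis_ints_approx: "\<exists>m\<in>eis_ints. cmod (z - m) < 1"
proof -
  \<comment> \<open>Since \<open>eis\<close> has imaginary part sqrt 3 / 2 and real part 1/2, these
    are the coordinates of \<open>z\<close> in the basis 1, \<open>eis\<close>.\<close>
  define y where "y = Im z * 2 / sqrt 3"
  define x where "x = Re z - y / 2"
  define u v where "u = x - of_int (round x)" and "v = y - of_int (round y)"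
  define m where "m = complex_of_int (round x) + of_int (round y) * eis"
  have z: "z = of_real x + of_real y * eis"
    by (simp add: complex_eq_iff x_def y_def)
  have uv: "\<bar>u\<bar> \<le> 1 / 2" "\<bar>v\<bar> \<le> 1 / 2"
    using of_int_round_abs_le[of x] of_int_round_abs_le[of y]
    by (simp_all add: u_def v_def abs_minus_commute)
  have "z - m = of_real u + of_real v * eis"
    by (simp add: z m_def u_def v_def algebra_simps)
  then have "(cmod (z - m))\<^sup>2 = u\<^sup>2 + u * v + v\<^sup>2"
    by (simp only: cmod_eis_coords)
  also have "\<dots> \<le> 3 / 4"
  proof -
    have "\<bar>u\<bar> * \<bar>u\<bar> \<le> 1/2 * (1/2)" "\<bar>v\<bar> * \<bar>v\<bar> \<le> 1/2 * (1/2)" "\<bar>u\<bar> * \<bar>v\<bar> \<le> 1/2 * (1/2)"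
      using uv by (intro mult_mono; simp)+
    moreover have "u * v \<le> \<bar>u\<bar> * \<bar>v\<bar>" by (metis abs_ge_self abs_mult)
    ultimately show ?thesis by (simp add: power2_eq_square)
  qed
  finally have "(cmod (z - m))\<^sup>2 < 1\<^sup>2" by simp
  then have "cmod (z - m) < 1" by (rule power_less_imp_less_base) simp
  moreover have "m \<in> eis_ints" by (simp add: m_def)
  ultimately show ?thesis by blast
qed

section \<open>Irreducible fractions\<close>

text \<open>In the ideal generated by \<open>p\<close> and \<open>q\<close>, a nonzero element of
  least norm divides every element by Euclidean division. As a common factor of \<open>p\<close> and
  \<open>q\<close> it has modulus 1, so it can be scaled to 1 inside the ideal.\<close>

lemma irreducible_frac_bezout:
  assumes "irreducible_frac p q"
  obtains a b where "a \<in> eis_ints" "b \<in> eis_ints" "a * p + b * q = 1"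
proof -
  have pq: "p \<in> eis_ints" "q \<in> eis_ints" "p \<noteq> 0 \<or> q \<noteq> 0"
    and irr: "\<And>k. k \<in> eis_ints \<Longrightarrow> eis_dvd k p \<Longrightarrow> eis_dvd k q \<Longrightarrow> cmod k = 1"
    using assms by (auto simp: irreducible_frac_def)
  define I where "I = {a * p + b * q | a b. a \<in> eis_ints \<and> b \<in> eis_ints}"
  have I_sub: "x - m * y \<in> I" if xym: "x \<in> I" "y \<in> I" "m \<in> eis_ints" for x y m
  proof -
    obtain a b c d where "a \<in> eis_ints" "b \<in> eis_ints" "c \<in> eis_ints" "d \<in> eis_ints"
      "x = a * p + b * q" "y = c * p + d * q"
      using xym(1,2) unfolding I_def by blast
    moreover from this have "x - m * y = (a - m * c) * p + (b - m * d) * q"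
      by (simp add: algebra_simps)
    ultimately show ?thesis using xym(3) unfolding I_def by blast
  qed
  have I_ints: "x \<in> eis_ints" if "x \<in> I" for x
    using that pq by (auto simp: I_def)
  have pI: "p \<in> I"
    unfolding I_def by (rule CollectI, rule exI[of _ 1], rule exI[of _ 0]) simp
  have qI: "q \<in> I"
    unfolding I_def by (rule CollectI, rule exI[of _ 0], rule exI[of _ 1]) simp
  have "\<exists>k. k \<in> I \<and> k \<noteq> 0" using pI qI pq by blast
  then obtain g where g: "g \<in> I" "g \<noteq> 0"
    and least: "\<And>y. y \<in> I \<Longrightarrow> y \<noteq> 0 \<Longrightarrow> nat \<lfloor>(cmod g)\<^sup>2\<rfloor> \<le> nat \<lfloor>(cmod y)\<^sup>2\<rfloor>"
    using ex_has_least_nat[of "\<lambda>k. k \<in> I \<and> k \<noteq> 0" _ "\<lambda>k. nat \<lfloor>(cmod k)\<^sup>2\<rfloor>"] by blast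
  have g_dvd: "eis_dvd g x" if "x \<in> I" for x
  proof -
    obtain m where m: "m \<in> eis_ints" "cmod (x / g - m) < 1"
      using eis_ints_approx by blast
    \<comment> \<open>The remainder of \<open>x\<close> on division by \<open>g\<close>: it lies in
      the ideal and has smaller norm than \<open>g\<close>, hence vanishes.\<close>
    define y where "y = x - m * g"
    have y: "y \<in> I" unfolding y_def using that g m by (intro I_sub)
    have "y = (x / g - m) * g" using g by (simp add: y_def field_simps)
    then have "cmod y = cmod (x / g - m) * cmod g" by (simp add: norm_mult)
    also have "\<dots> < cmod g" using m g by simp
    finally have "(cmod y)\<^sup>2 < (cmod g)\<^sup>2" by (rule power_strict_mono) simp_all
    then have "nat \<lfloor>(cmod y)\<^sup>2\<rfloor> < nat \<lfloor>(cmod g)\<^sup>2\<rfloor>"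
      using eis_ints_norm_nat[OF I_ints[OF y]] eis_ints_norm_nat[OF I_ints[OF g(1)]] by linarith
    then have "y = 0" using least[OF y] by (meson not_le)
    then show ?thesis unfolding eis_dvd_def y_def using m by (auto simp: mult.commute)
  qed
  have "cmod g = 1" using irr I_ints g g_dvd pI qI by blast
  \<comment> \<open>For modulus 1 the conjugate, again an Eisenstein integer, is the
    inverse.\<close>
  then have g1: "cnj g * g = 1"
    using complex_norm_square[of g] by (simp add: mult.commute)
  obtain a b where ab: "a \<in> eis_ints" "b \<in> eis_ints" "g = a * p + b * q"
    using g by (auto simp: I_def)
  have "(cnj g * a) * p + (cnj g * b) * q = cnj g * (a * p + b * q)"
    by (simp add: algebra_simps)
  also have "\<dots> = cnj g * g" by (simp only: ab(3))
  finally have "(cnj g * a) * p + (cnj g * b) * q = cnj g * g" .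
  with g1 have "(cnj g * a) * p + (cnj g * b) * q = 1" by (simp only:)
  moreover have "cnj g * a \<in> eis_ints" "cnj g * b \<in> eis_ints"
    using ab(1,2) I_ints[OF g(1)] by simp_all
  ultimately show ?thesis by (intro that)
qed

lemma frac_point_eq_iff:
  assumes "p \<noteq> 0 \<or> q \<noteq> 0" "p' \<noteq> 0 \<or> q' \<noteq> 0"
  shows "frac_point p q = frac_point p' q' \<longleftrightarrow> p * q' = p' * q"
  using assms by (auto simp: frac_point_def frac_eq_eq)

text \<open>Cross-multiplication turns a Bezout relation for (p, q) into the scaling factor k = a p'
  + b q'. This factor divides both p' and q', so irreducibility of the second fraction makes it a
  unit.\<close>

lemma irreducible_frac_unique:
  assumes "irreducible_frac p q" "irreducible_frac p' q'" "frac_point p q = frac_point p' q'"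
  obtains k where "cmod k = 1" "p' = k * p" "q' = k * q"
proof -
  have eq: "p * q' = p' * q"
    using assms frac_point_eq_iff[of p q p' q'] by (auto simp: irreducible_frac_def)
  obtain a b where ab: "a \<in> eis_ints" "b \<in> eis_ints" "a * p + b * q = 1"
    using irreducible_frac_bezout[OF assms(1)] by blast
  define k where "k = a * p' + b * q'"
  have k: "k \<in> eis_ints"
    using ab assms(2) by (auto simp: k_def irreducible_frac_def)
  have p': "p' = k * p"
  proof -
    have "k * p = a * p * p' + b * (p * q')" by (simp add: k_def algebra_simps)
    also have "\<dots> = (a * p + b * q) * p'" by (simp only: eq) (simp add: algebra_simps)
    finally show ?thesis using ab by simp
  qed
  have q': "q' = k * q"
  proof -
    have "k * q = a * (p' * q) + b * q * q'" by (simp add: k_def algebra_simps)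
    also have "\<dots> = (a * p + b * q) * q'" by (simp only: eq[symmetric]) (simp add: algebra_simps)
    finally show ?thesis using ab by simp
  qed
  have "eis_dvd k p'" "eis_dvd k q'"
    using p' q' assms(1) by (auto simp: eis_dvd_def irreducible_frac_def)
  then have "cmod k = 1"
    using k assms(2) by (auto simp: irreducible_frac_def)
  then show ?thesis using that p' q' by blast
qed

text \<open>Resolves the definite description: another choice of irreducible representatives
  multiplies the determinant by two factors of modulus 1.\<close>

lemma det_length_frac_point:
  assumes "irreducible_frac p q" "irreducible_frac p' q'"
  shows "det_length (frac_point p q) (frac_point p' q') = cmod (p * q' - p' * q)"
  unfolding det_length_def
proof (rule the_equality)
  show "\<exists>p1 q1 p2 q2. irreducible_frac p1 q1 \<and> frac_point p q = frac_point p1 q1 \<and>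
      irreducible_frac p2 q2 \<and> frac_point p' q' = frac_point p2 q2 \<and>
      cmod (p * q' - p' * q) = cmod (p1 * q2 - p2 * q1)"
    by (rule exI[of _ p], rule exI[of _ q], rule exI[of _ p'], rule exI[of _ q']) (simp add: assms)
next
  fix l
  assume "\<exists>p1 q1 p2 q2. irreducible_frac p1 q1 \<and> frac_point p q = frac_point p1 q1 \<and>
      irreducible_frac p2 q2 \<and> frac_point p' q' = frac_point p2 q2 \<and>
      l = cmod (p1 * q2 - p2 * q1)"
  then obtain p1 q1 p2 q2 where 1: "irreducible_frac p1 q1" "frac_point p q = frac_point p1 q1"
    and 2: "irreducible_frac p2 q2" "frac_point p' q' = frac_point p2 q2"
    and l: "l = cmod (p1 * q2 - p2 * q1)"
    by (elim exE conjE)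
  obtain k where k: "cmod k = 1" "p1 = k * p" "q1 = k * q"
    using irreducible_frac_unique[OF assms(1) 1] .
  obtain k' where k': "cmod k' = 1" "p2 = k' * p'" "q2 = k' * q'"
    using irreducible_frac_unique[OF assms(2) 2] .
  have "p1 * q2 - p2 * q1 = k * k' * (p * q' - p' * q)"
    by (simp add: k k' algebra_simps)
  then show "l = cmod (p * q' - p' * q)"
    by (simp add: l norm_mult k(1) k'(1))
qed

lemma frac_point_scale: "k \<noteq> 0 \<Longrightarrow> frac_point (k * p) (k * q) = frac_point p q"
  by (simp add: frac_point_def)

text \<open>A representation minimising the sum of the two norms is irreducible: cancelling a common
  factor \<open>k\<close> gives another representation, so minimality forces modulus of
  \<open>k\<close> at most 1.\<close>

lemma eis_field_hat_irreducible:
  assumes "X \<in> eis_field_hat"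
  obtains p q where "irreducible_frac p q" "X = frac_point p q"
proof -
  let ?P = "\<lambda>(p, q). p \<in> eis_ints \<and> q \<in> eis_ints \<and> (p \<noteq> 0 \<or> q \<noteq> 0) \<and> X = frac_point p q"
  let ?N = "\<lambda>x. nat \<lfloor>(cmod x)\<^sup>2\<rfloor>"
  have "\<exists>x. ?P x"
  proof (cases X)
    case None
    then have "?P (1, 0)" by (simp add: frac_point_def)
    then show ?thesis by blast
  next
    case (Some z)
    then obtain p q where "p \<in> eis_ints" "q \<in> eis_ints" "q \<noteq> 0" "z = p / q"
      using assms by (auto simp: eis_field_hat_def eis_field_def)
    then have "?P (p, q)" using Some by (simp add: frac_point_def)
    then show ?thesis by blast
  qed
  then obtain x\<^sub>0 where "?P x\<^sub>0" ..
  from ex_has_least_nat[of ?P, OF this, of "\<lambda>(p, q). ?N p + ?N q"]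
  obtain x where x: "?P x" "\<forall>y. ?P y \<longrightarrow> (\<lambda>(p, q). ?N p + ?N q) x \<le> (\<lambda>(p, q). ?N p + ?N q) y"
    by (elim exE conjE)
  obtain p q where x_eq: "x = (p, q)" by (cases x)
  have pq: "p \<in> eis_ints" "q \<in> eis_ints" "p \<noteq> 0 \<or> q \<noteq> 0" "X = frac_point p q"
    using x(1) by (simp_all add: x_eq)
  have least: "?N p + ?N q \<le> ?N p' + ?N q'" if "?P (p', q')" for p' q'
    using x(2)[rule_format, OF that] by (simp add: x_eq)
  have "cmod k = 1" if k: "k \<in> eis_ints" "eis_dvd k p" "eis_dvd k q" for k
  proof -
    obtain m n where mn: "m \<in> eis_ints" "n \<in> eis_ints" "p = k * m" "q = k * n"
      using k by (auto simp: eis_dvd_def)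
    have "k \<noteq> 0" "m \<noteq> 0 \<or> n \<noteq> 0" using pq mn by auto
    then have "?N p + ?N q \<le> ?N m + ?N n"
      using least[of m n] pq mn by (simp add: frac_point_scale)
    then have "(cmod p)\<^sup>2 + (cmod q)\<^sup>2 \<le> (cmod m)\<^sup>2 + (cmod n)\<^sup>2"
      using pq mn eis_ints_norm_nat[of p] eis_ints_norm_nat[of q]
        eis_ints_norm_nat[of m] eis_ints_norm_nat[of n] by linarith
    then have "(cmod k)\<^sup>2 * ((cmod m)\<^sup>2 + (cmod n)\<^sup>2) \<le> 1 * ((cmod m)\<^sup>2 + (cmod n)\<^sup>2)"
      by (simp add: mn norm_mult power_mult_distrib algebra_simps)
    moreover have "0 < (cmod m)\<^sup>2 + (cmod n)\<^sup>2"
      using \<open>m \<noteq> 0 \<or> n \<noteq> 0\<close> by (auto simp: add_pos_nonneg add_nonneg_pos)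
    ultimately have "(cmod k)\<^sup>2 \<le> 1" by (simp only: mult_le_cancel_right_pos)
    then have "cmod k \<le> 1" by (simp add: power2_nonneg_ge_1_iff abs_square_le_1)
    with eis_ints_cmod_ge_1[OF k(1) \<open>k \<noteq> 0\<close>] show ?thesis by simp
  qed
  then have "irreducible_frac p q" using pq by (auto simp: irreducible_frac_def)
  then show ?thesis using that pq by blast
qed

lemma irreducible_frac_1:
  assumes "x \<in> eis_ints"
  shows "irreducible_frac x 1" "irreducible_frac 1 x"
proof -
  have "cmod k = 1" if "k \<in> eis_ints" "eis_dvd k 1" for k
    using that eis_ints_unit[of k] by (force simp: eis_dvd_def)
  then show "irreducible_frac x 1" "irreducible_frac 1 x"
    using assms by (auto simp: irreducible_frac_def)
qed

text \<open>The determinant \<open>D\<close> has inverse \<open>cnj D\<close>, so the inverse matrix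
  is again integral. Every common factor of the image pair therefore divides \<open>p\<close> and
  \<open>q\<close>.\<close>

lemma irreducible_frac_unimodular:
  assumes abcd: "a \<in> eis_ints" "b \<in> eis_ints" "c \<in> eis_ints" "d \<in> eis_ints"
    and det: "cmod (a * d - b * c) = 1"
    and irr: "irreducible_frac p q"
  shows "irreducible_frac (a * p + b * q) (c * p + d * q)"
proof -
  define D where "D = a * d - b * c"
  have "D * cnj D = 1"
    using det complex_norm_square[of D] by (simp flip: D_def)
  then have D: "D \<in> eis_ints" "cnj D * D = 1"
    using abcd by (auto simp: D_def mult.commute)
  have pq: "p \<in> eis_ints" "q \<in> eis_ints" "p \<noteq> 0 \<or> q \<noteq> 0"
    using irr by (auto simp: irreducible_frac_def)
  \<comment> \<open>Cramer's rule, with \<open>cnj D\<close> in place of division by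
    \<open>D\<close>.\<close>
  have solve: "p = cnj D * (d * (a * p + b * q) - b * (c * p + d * q))"
    "q = cnj D * (a * (c * p + d * q) - c * (a * p + b * q))"
  proof -
    have "cnj D * (d * (a * p + b * q) - b * (c * p + d * q)) = cnj D * D * p"
      "cnj D * (a * (c * p + d * q) - c * (a * p + b * q)) = cnj D * D * q"
      by (simp_all add: D_def algebra_simps)
    then show "p = cnj D * (d * (a * p + b * q) - b * (c * p + d * q))"
      "q = cnj D * (a * (c * p + d * q) - c * (a * p + b * q))"
      using D by simp_all
  qed
  have "cmod k = 1" if k: "k \<in> eis_ints" "eis_dvd k (a * p + b * q)" "eis_dvd k (c * p + d * q)" for k
  proof -
    obtain m n where mn: "m \<in> eis_ints" "n \<in> eis_ints" "a * p + b * q = k * m" "c * p + d * q = k * n"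
      using k by (auto simp: eis_dvd_def)
    have "p = k * (cnj D * (d * m - b * n))" "q = k * (cnj D * (a * n - c * m))"
      using solve by (simp_all add: mn algebra_simps)
    then have "eis_dvd k p" "eis_dvd k q"
      unfolding eis_dvd_def using abcd D mn by blast+
    then show ?thesis using irr k by (auto simp: irreducible_frac_def)
  qed
  moreover have "\<not> (a * p + b * q = 0 \<and> c * p + d * q = 0)"
    using solve pq by (metis diff_zero mult_zero_right)
  ultimately show ?thesis using abcd pq by (auto simp: irreducible_frac_def)
qed

section \<open>The action of the reflection group on the boundary\<close>

text \<open>Homogeneous coordinates treat infinity like any other point. The map \<tau> separates
  the holomorphic from the antiholomorphic maps; only the values of \<open>h\<close> on the boundary
  are constrained.\<close>

definition eis_moebius :: "((complex \<times> real) option \<Rightarrow> (complex \<times> real) option) \<Rightarrow> bool" where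
  "eis_moebius h \<longleftrightarrow> (\<exists>\<tau>\<in>{\<lambda>z. z, cnj}. \<exists>a\<in>eis_ints. \<exists>b\<in>eis_ints. \<exists>c\<in>eis_ints. \<exists>d\<in>eis_ints.
     cmod (a * d - b * c) = 1 \<and>
     (\<forall>p q. p \<noteq> 0 \<or> q \<noteq> 0 \<longrightarrow> h (ideal_point (frac_point p q)) =
        ideal_point (frac_point (a * \<tau> p + b * \<tau> q) (c * \<tau> p + d * \<tau> q))))"

lemma eis_moebius_id: "eis_moebius (\<lambda>x. x)"
  unfolding eis_moebius_def
  by (rule bexI[of _ "\<lambda>z. z"], rule bexI[of _ 1], rule bexI[of _ 0],
      rule bexI[of _ 0], rule bexI[of _ 1]) auto

lemma eis_moebius_cnjI:
  assumes "a \<in> eis_ints" "b \<in> eis_ints" "c \<in> eis_ints" "d \<in> eis_ints" "cmod (a * d - b * c) = 1"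
    and "\<And>p q. p \<noteq> 0 \<or> q \<noteq> 0 \<Longrightarrow> h (ideal_point (frac_point p q)) =
        ideal_point (frac_point (a * cnj p + b * cnj q) (c * cnj p + d * cnj q))"
  shows "eis_moebius h"
  unfolding eis_moebius_def using assms by blast

text \<open>Because \<tau> is a ring automorphism preserving modulus and Eisenstein integers, the
  composite has as its matrix the first matrix times the \<tau>-image of the second, with twist
  \<tau> after \<tau>'.\<close>

lemma eis_moebius_comp:
  assumes "eis_moebius h" "eis_moebius g"
  shows "eis_moebius (h \<circ> g)"
proof -
  obtain \<tau> a b c d where tau: "\<tau> \<in> {\<lambda>z. z, cnj}"
    and abcd: "a \<in> eis_ints" "b \<in> eis_ints" "c \<in> eis_ints" "d \<in> eis_ints" "cmod (a * d - b * c) = 1"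
    and h: "\<And>p q. p \<noteq> 0 \<or> q \<noteq> 0 \<Longrightarrow> h (ideal_point (frac_point p q)) =
        ideal_point (frac_point (a * \<tau> p + b * \<tau> q) (c * \<tau> p + d * \<tau> q))"
    using assms(1) unfolding eis_moebius_def by blast
  obtain \<tau>' a' b' c' d' where tau': "\<tau>' \<in> {\<lambda>z. z, cnj}"
    and abcd': "a' \<in> eis_ints" "b' \<in> eis_ints" "c' \<in> eis_ints" "d' \<in> eis_ints" "cmod (a' * d' - b' * c') = 1"
    and g: "\<And>p q. p \<noteq> 0 \<or> q \<noteq> 0 \<Longrightarrow> g (ideal_point (frac_point p q)) =
        ideal_point (frac_point (a' * \<tau>' p + b' * \<tau>' q) (c' * \<tau>' p + d' * \<tau>' q))"
    using assms(2) unfolding eis_moebius_def by blast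
  have hom: "\<tau> (x + y) = \<tau> x + \<tau> y" "\<tau> (x * y) = \<tau> x * \<tau> y" "\<tau> (x - y) = \<tau> x - \<tau> y"
    "cmod (\<tau> x) = cmod x" for x y
    using tau by auto
  have ints: "\<tau> x \<in> eis_ints" if "x \<in> eis_ints" for x
    using tau that by auto
  have tau0: "\<tau>' x = 0 \<longleftrightarrow> x = 0" for x
    using tau' by auto
  define \<rho> where "\<rho> = (\<lambda>z. \<tau> (\<tau>' z))"
  have rho: "\<rho> \<in> {\<lambda>z. z, cnj}" using tau tau' by (auto simp: \<rho>_def)
  have act: "(h \<circ> g) (ideal_point (frac_point p q)) =
      ideal_point (frac_point ((a * \<tau> a' + b * \<tau> c') * \<rho> p + (a * \<tau> b' + b * \<tau> d') * \<rho> q)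
        ((c * \<tau> a' + d * \<tau> c') * \<rho> p + (c * \<tau> b' + d * \<tau> d') * \<rho> q))"
    if pq: "p \<noteq> 0 \<or> q \<noteq> 0" for p q
  proof -
    \<comment> \<open>The formula for \<open>h\<close> applies only to a pair that is not (0, 0);
      invertibility of the second matrix guarantees this.\<close>
    have "a' * \<tau>' p + b' * \<tau>' q \<noteq> 0 \<or> c' * \<tau>' p + d' * \<tau>' q \<noteq> 0"
    proof (rule ccontr)
      assume "\<not> ?thesis"
      then have 0: "a' * \<tau>' p + b' * \<tau>' q = 0" "c' * \<tau>' p + d' * \<tau>' q = 0" by auto
      have "(a' * d' - b' * c') * \<tau>' p = d' * (a' * \<tau>' p + b' * \<tau>' q) - b' * (c' * \<tau>' p + d' * \<tau>' q)"
        "(a' * d' - b' * c') * \<tau>' q = a' * (c' * \<tau>' p + d' * \<tau>' q) - c' * (a' * \<tau>' p + b' * \<tau>' q)"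
        by (simp_all add: algebra_simps)
      then have "(a' * d' - b' * c') * \<tau>' p = 0" "(a' * d' - b' * c') * \<tau>' q = 0"
        unfolding 0 by simp_all
      moreover have "a' * d' - b' * c' \<noteq> 0" using abcd'(5) by auto
      ultimately show False using pq tau0 by auto
    qed
    then show ?thesis
      by (simp add: g[OF pq] h hom \<rho>_def algebra_simps)
  qed
  have det: "cmod ((a * \<tau> a' + b * \<tau> c') * (c * \<tau> b' + d * \<tau> d') -
      (a * \<tau> b' + b * \<tau> d') * (c * \<tau> a' + d * \<tau> c')) = 1"
  proof -
    have "(a * \<tau> a' + b * \<tau> c') * (c * \<tau> b' + d * \<tau> d') -
      (a * \<tau> b' + b * \<tau> d') * (c * \<tau> a' + d * \<tau> c') = (a * d - b * c) * \<tau> (a' * d' - b' * c')"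
      by (simp add: hom algebra_simps)
    then show ?thesis using abcd abcd' by (simp add: norm_mult hom(4))
  qed
  show ?thesis
    unfolding eis_moebius_def
    by (rule bexI[OF _ rho], rule bexI[of _ "a * \<tau> a' + b * \<tau> c'"],
        rule bexI[of _ "a * \<tau> b' + b * \<tau> d'"], rule bexI[of _ "c * \<tau> a' + d * \<tau> c'"],
        rule bexI[of _ "c * \<tau> b' + d * \<tau> d'"])
      (use act det abcd abcd' ints in auto)
qed

section \<open>Inversions and reflections in homogeneous coordinates\<close>

text \<open>With w = v - c, the two successive scalings r^2 / |w|^2 and |w|^2 / r^2 cancel.\<close>

lemma sphere_inversion_involution:
  assumes "r \<noteq> 0"
  shows "sphere_inversion c r (sphere_inversion c r x) = x"
proof (cases x)
  case None
  then show ?thesis by (simp add: sphere_inversion_def)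
next
  case (Some v)
  show ?thesis
  proof (cases "v = c")
    case True
    then show ?thesis using Some by (simp add: sphere_inversion_def)
  next
    case False
    define w where "w = v - c"
    have w: "w \<noteq> 0" "v = c + w" using False by (auto simp: w_def)
    show ?thesis using assms w Some
      by (simp add: sphere_inversion_def power_mult_distrib power_divide power2_eq_square)
  qed
qed

text \<open>The offset \<open>t\<close> from the plane changes sign, so the second correction undoes
  the first.\<close>

lemma plane_reflection_involution:
  assumes "n \<noteq> 0"
  shows "plane_reflection n b (plane_reflection n b x) = x"
proof (cases x)
  case None
  then show ?thesis by (simp add: plane_reflection_def)
next
  case (Some v)
  define t where "t = n \<bullet> v - b"
  have "n \<bullet> (v - (2 * t / (n \<bullet> n)) *\<^sub>R n) - b = - t"
    using assms by (simp add: inner_diff_right t_def)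
  then show ?thesis
    by (simp only: Some plane_reflection_def option.map t_def[symmetric]) simp
qed

lemma sphere_inversion_ideal_point:
  "sphere_inversion (c, 0) r (ideal_point x) = ideal_point (sphere_inversion c r x)"
  by (cases x) (auto simp: sphere_inversion_def ideal_point_def norm_Pair)

lemma plane_reflection_ideal_point:
  "plane_reflection (n, 0) b (ideal_point x) = ideal_point (plane_reflection n b x)"
  by (cases x) (auto simp: plane_reflection_def ideal_point_def)

text \<open>Inversion in a circle is z -> c + r^2 / cnj (z - c); the right-hand side is this map
  cleared of denominators. The two degenerate cases exchange infinity and the centre.\<close>

lemma sphere_inversion_frac_point:
  assumes "p \<noteq> 0 \<or> q \<noteq> 0" "r \<noteq> 0"
  shows "sphere_inversion c r (frac_point p q) =
    frac_point (c * cnj (p - c * q) + (of_real r)\<^sup>2 * cnj q) (cnj (p - c * q))"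
proof (cases "q = 0")
  case True
  then show ?thesis using assms by (simp add: frac_point_def sphere_inversion_def)
next
  case q: False
  show ?thesis
  proof (cases "p = c * q")
    case True
    then show ?thesis using q by (simp add: frac_point_def sphere_inversion_def)
  next
    case False
    define w where "w = p / q - c"
    have w: "w \<noteq> 0" "p - c * q = w * q" "p / q \<noteq> c" using q False by (auto simp: w_def field_simps)
    have "((r\<^sup>2 / (cmod w)\<^sup>2) *\<^sub>R w) = (of_real r)\<^sup>2 / cnj w"
      using w(1) complex_norm_square[of w] by (simp add: scaleR_conv_of_real)
    then have "sphere_inversion c r (frac_point p q) = Some (c + (of_real r)\<^sup>2 / cnj w)"
      using q w by (simp add: frac_point_def sphere_inversion_def flip: w_def)
    moreover have "c + (of_real r)\<^sup>2 / cnj w =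
        (c * cnj (p - c * q) + (of_real r)\<^sup>2 * cnj q) / cnj (p - c * q)"
      unfolding w(2) using q w(1) by (simp add: field_simps)
    moreover have "cnj (p - c * q) \<noteq> 0" using False by (simp only: complex_cnj_zero_iff) simp
    ultimately show ?thesis by (simp only: frac_point_def if_False)
  qed
qed

text \<open>Reflection in the line through \<open>P\<close> with unit direction \<open>u\<close> is
  z -> P + u^2 cnj (z - P). The normal \<open>n\<close> drops out, since orthogonality to
  \<open>u\<close> gives n / cnj n = - u^2.\<close>

lemma plane_reflection_frac_point:
  assumes n: "n \<noteq> 0" and P: "n \<bullet> P = b" "n \<bullet> (P + u) = b" and u: "cmod u = 1"
  shows "plane_reflection n b (frac_point p q) =
    frac_point (u\<^sup>2 * cnj p + (P - u\<^sup>2 * cnj P) * cnj q) (cnj q)"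
proof (cases "q = 0")
  case True
  then show ?thesis by (simp add: frac_point_def plane_reflection_def)
next
  case q: False
  define z where "z = p / q - P"
  have pq: "p / q = P + z" by (simp add: z_def)
  have uu: "u * cnj u = 1" using u by (simp add: complex_norm_square[symmetric])
  have inner: "2 * complex_of_real (x \<bullet> y) = x * cnj y + cnj x * y" for x y
    by (simp add: complex_eq_iff inner_complex_def)
  have "n \<bullet> u = 0" using P by (simp add: inner_add_right)
  then have "n * cnj u + cnj n * u = 0" using inner[of n u] by simp
  \<comment> \<open>Multiply the orthogonality relation by \<open>u\<close>, so that u cnj u = 1 can
    be used.\<close>
  then have "n * (u * cnj u) + u\<^sup>2 * cnj n = 0"
    using distrib_left[of u "n * cnj u" "cnj n * u"] by (simp add: power2_eq_square mult_ac)
  then have nu: "n = - (u\<^sup>2 * cnj n)"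
    by (simp add: uu eq_neg_iff_add_eq_0)
  have "(2 * (n \<bullet> (P + z) - b) / (n \<bullet> n)) *\<^sub>R n = (2 * (n \<bullet> z) / (n \<bullet> n)) *\<^sub>R n"
    using P by (simp add: inner_add_right)
  also have "\<dots> = (n * cnj z + cnj n * z) * n / (n * cnj n)"
    by (simp only: scaleR_conv_of_real of_real_divide of_real_mult of_real_numeral inner
        dot_square_norm complex_norm_square) simp
  also have "\<dots> = z + n / cnj n * cnj z" using n by (simp add: field_simps)
  also have "n / cnj n = - u\<^sup>2" using n by (subst nu) simp
  finally have "P + z - (2 * (n \<bullet> (P + z) - b) / (n \<bullet> n)) *\<^sub>R n = P + u\<^sup>2 * cnj z"
    by simp
  also have "\<dots> = (u\<^sup>2 * cnj p + (P - u\<^sup>2 * cnj P) * cnj q) / cnj q"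
    using q by (simp add: z_def field_simps)
  finally show ?thesis using q by (simp add: frac_point_def plane_reflection_def pq)
qed

section \<open>Reflections in the faces of the base tetrahedron\<close>

text \<open>The face opposite infinity lies on a hemisphere, the others on vertical half-planes. In
  the vertical case \<open>P\<close> is one finite vertex of the face and \<open>P + u\<close> the
  other.\<close>

lemma face_reflections_cases:
  assumes "\<rho> \<in> face_reflections"
  obtains (hemisphere) c r where "r > 0" "\<rho> = sphere_inversion (c, 0) r"
      "cmod c = r" "cmod (1 - c) = r" "cmod (eis - c) = r"
  | (vertical) n b P u where "n \<noteq> 0" "\<rho> = plane_reflection (n, 0) b" "n \<bullet> P = b" "n \<bullet> (P + u) = b"
      "(P, u) \<in> {(0, 1), (0, eis), (1, eis - 1)}"
proof -
  obtain v P where v: "v \<in> base_vertices" "base_vertices - {v} \<subseteq> P" "hyp_reflection P \<rho>"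
    using assms by (auto simp: face_reflections_def)
  have base: "base_vertices = {Some (0, 0), Some (1, 0), Some (eis, 0), None}"
    by (simp add: base_vertices_def ideal_point_def)
  from v(3) show ?thesis
  proof cases
    case (hemisphere r c)
    \<comment> \<open>A hemisphere misses infinity, so infinity must be the opposite vertex and the
      other three vertices lie on the sphere.\<close>
    have "None \<notin> P" using hemisphere by auto
    then have "v = None" using v base by auto
    then have "Some (0, 0) \<in> P" "Some (1, 0) \<in> P" "Some (eis, 0) \<in> P"
      using v base by auto
    then have "cmod c = r" "cmod (1 - c) = r" "cmod (eis - c) = r"
      using hemisphere(1) by (auto simp: dist_Pair_Pair dist_norm norm_minus_commute)
    then show ?thesis using that(1) hemisphere by blast
  next
    case (vertical n b)
    have on_line: "n \<bullet> z = b" if "Some (z, 0) \<in> base_vertices" "v \<noteq> Some (z, 0)" for z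
    proof -
      have "Some (z, 0) \<in> P" using that v(2) by blast
      then show ?thesis unfolding vertical(1) by auto
    qed
    have mem: "Some (0, 0) \<in> base_vertices" "Some (1, 0) \<in> base_vertices"
      "Some (eis, 0) \<in> base_vertices"
      by (simp_all add: base)
    \<comment> \<open>Each case keeps two finite vertices on the line; when \<open>v\<close> is
      neither 0 nor 1, these are 0 and 1.\<close>
    consider "v = Some (0, 0)" | "v = Some (1, 0)" | "v \<noteq> Some (0, 0)" "v \<noteq> Some (1, 0)" by blast
    then show ?thesis
    proof cases
      case 1
      then have "n \<bullet> 1 = b" "n \<bullet> (1 + (eis - 1)) = b"
        using on_line[OF mem(2)] on_line[OF mem(3)] eis_neq by simp_all
      then show ?thesis by (intro that(2)[OF vertical(3,2), where P = 1 and u = "eis - 1"]) simp_all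
    next
      case 2
      then have "n \<bullet> 0 = b" "n \<bullet> (0 + eis) = b"
        using on_line[OF mem(1)] on_line[OF mem(3)] eis_neq(2)[symmetric] by simp_all
      then show ?thesis by (intro that(2)[OF vertical(3,2), where P = 0 and u = eis]) simp_all
    next
      case 3
      then have "n \<bullet> 0 = b" "n \<bullet> (0 + 1) = b"
        using on_line[OF mem(1)] on_line[OF mem(2)] by simp_all
      then show ?thesis by (intro that(2)[OF vertical(3,2), where P = 0 and u = 1]) simp_all
    qed
  qed
qed

lemma face_reflections_involution:
  assumes "\<rho> \<in> face_reflections"
  shows "\<rho> (\<rho> x) = x"
  using assms
  by (cases rule: face_reflections_cases)
    (simp_all add: sphere_inversion_involution plane_reflection_involution zero_prod_def)

text \<open>Incidence with the vertices determines the hemisphere and the lines; their formulas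
  become integral, with unit determinant, after clearing denominators.\<close>

lemma face_reflections_eis_moebius:
  assumes "\<rho> \<in> face_reflections"
  shows "eis_moebius \<rho>"
  using assms
proof (cases rule: face_reflections_cases)
  case (hemisphere c r)
  have s3: "sqrt 3 * sqrt 3 = (3::real)" by simp
  have sq: "(Re c)\<^sup>2 + (Im c)\<^sup>2 = r\<^sup>2" "(1 - Re c)\<^sup>2 + (Im c)\<^sup>2 = r\<^sup>2"
    "(1 / 2 - Re c)\<^sup>2 + (sqrt 3 / 2 - Im c)\<^sup>2 = r\<^sup>2"
    using arg_cong[OF hemisphere(3), of "\<lambda>x. x\<^sup>2"] arg_cong[OF hemisphere(4), of "\<lambda>x. x\<^sup>2"]
      arg_cong[OF hemisphere(5), of "\<lambda>x. x\<^sup>2"]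
    by (simp_all add: cmod_power2)
  \<comment> \<open>Differences of the equidistance equations are linear in the coordinates of
    \<open>c\<close>; they yield the circumcentre of the triangle 0, 1, \<open>eis\<close>.\<close>
  have re: "Re c = 1 / 2" using sq(1,2) by (simp add: power2_eq_square algebra_simps)
  have "sqrt 3 * Im c = 1 / 2"
    using sq(1,3) re s3 by (simp add: power2_eq_square algebra_simps)
  then have "sqrt 3 * (sqrt 3 * Im c) = sqrt 3 / 2" by simp
  then have "3 * Im c = sqrt 3 / 2" by (simp only: mult.assoc[symmetric] s3)
  then have im: "Im c = sqrt 3 / 6" by simp
  have c: "c = (1 + eis) / 3" by (simp add: complex_eq_iff re im)
  have r2: "r\<^sup>2 = 1 / 3" using sq(1) by (simp add: re im power2_eq_square)
  have rc: "(complex_of_real r)\<^sup>2 = 1 / 3" by (simp flip: of_real_power add: r2)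
  show ?thesis
  \<comment> \<open>Scaling both coordinates by 1 + eis clears the thirds, since (1 + eis) c = eis
    and (1 + eis) cnj c = 1. The determinant is - eis.\<close>
  proof (rule eis_moebius_cnjI[of eis 0 "1 + eis" "- 1"])
    fix p q :: complex
    assume pq: "p \<noteq> 0 \<or> q \<noteq> 0"
    have k: "1 + eis \<noteq> 0" by (simp add: complex_eq_iff)
    have cc: "(1 + eis) * c = eis" "c * cnj c = 1 / 3" "(1 + eis) * cnj c = 1"
      by (simp_all add: c complex_eq_iff field_simps)
    have "sphere_inversion c r (frac_point p q) =
        frac_point ((1 + eis) * (c * cnj (p - c * q) + (of_real r)\<^sup>2 * cnj q))
          ((1 + eis) * cnj (p - c * q))"
      using hemisphere pq by (simp only: sphere_inversion_frac_point frac_point_scale[OF k])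
    also have "c * cnj (p - c * q) + (of_real r)\<^sup>2 * cnj q = c * cnj p - (c * cnj c) * cnj q + 1 / 3 * cnj q"
      by (simp add: rc algebra_simps)
    also have "\<dots> = c * cnj p" by (simp add: cc(2))
    also have "(1 + eis) * (c * cnj p) = eis * cnj p + 0 * cnj q"
      by (simp add: cc(1) flip: mult.assoc)
    also have "(1 + eis) * cnj (p - c * q) = (1 + eis) * cnj p - ((1 + eis) * cnj c) * cnj q"
      by (simp add: algebra_simps)
    also have "\<dots> = (1 + eis) * cnj p + - 1 * cnj q"
      by (simp only: cc(3)) simp
    finally show "\<rho> (ideal_point (frac_point p q)) =
        ideal_point (frac_point (eis * cnj p + 0 * cnj q) ((1 + eis) * cnj p + - 1 * cnj q))"
      by (simp only: hemisphere sphere_inversion_ideal_point)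
  qed auto
next
  case (vertical n b P u)
  have "u \<in> eis_ints" "P \<in> eis_ints" using vertical(5) by auto
  \<comment> \<open>The third edge direction is a power of \<open>eis\<close>, so all three
    directions are units.\<close>
  have "eis - 1 = eis * eis" by (simp add: eis_squared)
  then have u: "cmod u = 1" using vertical(5) by (auto simp: norm_mult)
  show ?thesis
  proof (rule eis_moebius_cnjI[of "u\<^sup>2" "P - u\<^sup>2 * cnj P" 0 1])
    show "\<rho> (ideal_point (frac_point p q)) =
        ideal_point (frac_point (u\<^sup>2 * cnj p + (P - u\<^sup>2 * cnj P) * cnj q) (0 * cnj p + 1 * cnj q))"
      for p q
      by (simp add: vertical(2) plane_reflection_ideal_point
          plane_reflection_frac_point[OF vertical(1,3,4) u])
  qed (use \<open>u \<in> eis_ints\<close> \<open>P \<in> eis_ints\<close> u in \<open>auto simp: power2_eq_square norm_mult\<close>)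
qed

section \<open>The whole group and the fundamental tetrahedra\<close>

text \<open>Induction over the generated subgroup. The generators are involutions, so their inverses
  are generators again; injectivity later keeps the four vertices distinct.\<close>

lemma reflection_group_eis_moebius:
  assumes "h \<in> reflection_group"
  shows "eis_moebius h" "inj h"
proof -
  interpret group "BijGroup (UNIV :: (complex \<times> real) option set)"
    by (rule group_BijGroup)
  have carrier: "carrier (BijGroup UNIV) = {f. bij f}"
    by (auto simp: BijGroup_def Bij_def)
  have mult: "f \<otimes>\<^bsub>BijGroup UNIV\<^esub> g = f \<circ> g" if "bij f" "bij g"
    for f g :: "(complex \<times> real) option \<Rightarrow> (complex \<times> real) option"
    using that by (simp add: BijGroup_def Bij_def compose_def fun_eq_iff)
  have one_fun: "\<one>\<^bsub>BijGroup UNIV\<^esub> = (\<lambda>x. x)"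
    by (simp add: BijGroup_def fun_eq_iff)
  have bij: "bij \<rho>" if "\<rho> \<in> face_reflections" for \<rho>
    using face_reflections_involution[OF that] by (intro o_bij[of \<rho>]) (auto simp: fun_eq_iff)
  then have sub: "face_reflections \<subseteq> carrier (BijGroup UNIV)"
    by (auto simp: carrier)
  show "inj h"
    using generate_in_carrier[OF sub] assms
    by (simp add: reflection_group_def carrier bij_is_inj)
  have "h \<in> generate (BijGroup UNIV) face_reflections"
    using assms by (simp add: reflection_group_def)
  then show "eis_moebius h"
  proof induction
    case one
    show ?case by (simp only: one_fun eis_moebius_id)
  next
    case (incl h)
    then show ?case by (rule face_reflections_eis_moebius)
  next
    case (inv h)
    have "h \<otimes>\<^bsub>BijGroup UNIV\<^esub> h = \<one>\<^bsub>BijGroup UNIV\<^esub>"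
      using face_reflections_involution[OF inv] by (simp add: mult bij inv one_fun fun_eq_iff)
    then have "inv\<^bsub>BijGroup UNIV\<^esub> h = h"
      using sub inv by (intro inv_equality) auto
    then show ?case using face_reflections_eis_moebius[OF inv] by simp
  next
    case (eng h1 h2)
    then have "bij h1" "bij h2"
      using generate_in_carrier[OF sub] by (auto simp: carrier)
    then show ?case using eng by (simp only: mult eis_moebius_comp)
  qed
qed

text \<open>The base vertices have homogeneous coordinates (0, 1), (1, 1), (eis, 1), (1, 0).
  Conjugation fixes all of these except \<open>eis\<close>, which is why only \<open>s\<close>
  depends on the twist.\<close>

lemma fundamental_tetrahedron_vertices:
  assumes "fundamental_tetrahedron V"
  obtains s a b c d where "s \<in> {eis, cnj eis}"
    "a \<in> eis_ints" "b \<in> eis_ints" "c \<in> eis_ints" "d \<in> eis_ints" "cmod (a * d - b * c) = 1"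
    "V = (\<lambda>(p, q). frac_point (a * p + b * q) (c * p + d * q)) ` {(0, 1), (1, 1), (s, 1), (1, 0)}"
    "card V = 4"
proof -
  obtain h where h: "h \<in> reflection_group" "ideal_point ` V = h ` base_vertices"
    using assms by (auto simp: fundamental_tetrahedron_def)
  obtain \<tau> a b c d where tau: "\<tau> \<in> {\<lambda>z. z, cnj}"
    and abcd: "a \<in> eis_ints" "b \<in> eis_ints" "c \<in> eis_ints" "d \<in> eis_ints" "cmod (a * d - b * c) = 1"
    and act: "\<And>p q. p \<noteq> 0 \<or> q \<noteq> 0 \<Longrightarrow> h (ideal_point (frac_point p q)) =
        ideal_point (frac_point (a * \<tau> p + b * \<tau> q) (c * \<tau> p + d * \<tau> q))"
    using reflection_group_eis_moebius(1)[OF h(1)] unfolding eis_moebius_def by blast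
  have inj: "inj ideal_point"
    unfolding ideal_point_def by (intro option.inj_map injI) simp
  have "\<tau> 0 = 0" "\<tau> 1 = 1" using tau by auto
  moreover have "h ` base_vertices = {h (ideal_point (frac_point 0 1)), h (ideal_point (frac_point 1 1)),
      h (ideal_point (frac_point eis 1)), h (ideal_point (frac_point 1 0))}"
    by (simp add: base_vertices_def frac_point_def)
  ultimately have "ideal_point ` V = ideal_point `
      (\<lambda>(p, q). frac_point (a * p + b * q) (c * p + d * q)) ` {(0, 1), (1, 1), (\<tau> eis, 1), (1, 0)}"
    by (simp add: h(2) act)
  then have V: "V = (\<lambda>(p, q). frac_point (a * p + b * q) (c * p + d * q)) `
      {(0, 1), (1, 1), (\<tau> eis, 1), (1, 0)}"
    using inj by (simp only: inj_image_eq_iff)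
  have "card V = card base_vertices"
    by (metis card_image h(2) inj inj_on_subset reflection_group_eis_moebius(2)[OF h(1)] subset_UNIV)
  also have "card base_vertices = 4"
    using eis_neq(2)[symmetric] eis_neq(1)[symmetric]
    by (simp add: base_vertices_def ideal_point_def del: eis_neq)
  finally show ?thesis using that[of "\<tau> eis" a b c d] tau abcd V by auto
qed

section \<open>The quadratic relation\<close>

text \<open>Everything is expressed through A, B and the real and imaginary parts of \<alpha> cnj
  \<beta>. The sum-of-squares form is equivalent to the relation between squares and pairwise
  products.\<close>

lemma tetrahedron_identity:
  fixes \<alpha> \<beta> s :: complex
  assumes s: "s \<in> {eis, cnj eis}"
  defines "A \<equiv> (cmod \<alpha>)\<^sup>2" and "B \<equiv> (cmod \<beta>)\<^sup>2"
    and "C \<equiv> (cmod (\<alpha> + \<beta>))\<^sup>2" and "D \<equiv> (cmod (s * \<alpha> + \<beta>))\<^sup>2"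
  shows "3 * (A\<^sup>2 + B\<^sup>2 + C\<^sup>2 + D\<^sup>2) = (A + B + C + D)\<^sup>2"
proof -
  define x y where "x = Re (\<alpha> * cnj \<beta>)" and "y = Im (\<alpha> * cnj \<beta>)"
  \<comment> \<open>The sign of \<open>e\<close> distinguishes \<open>eis\<close> from its
    conjugate; the computation uses only e^2 = 3.\<close>
  obtain e :: real where e: "e\<^sup>2 = 3" "Re s = 1 / 2" "Im s = e / 2"
  proof (cases "s = eis")
    case True
    then show ?thesis using that[of "sqrt 3"] by simp
  next
    case False
    then show ?thesis using s that[of "- sqrt 3"] by simp
  qed
  have AB: "A * B = x\<^sup>2 + y\<^sup>2"
    unfolding A_def B_def x_def y_def cmod_power2[symmetric]
    by (simp add: norm_mult power_mult_distrib)
  have C: "C = A + B + 2 * x"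
    unfolding A_def B_def C_def x_def cmod_power2 by (simp add: power2_eq_square algebra_simps)
  have "cmod (s * \<alpha>) = cmod \<alpha>" using s by (auto simp: norm_mult)
  moreover have "(cmod (z + \<beta>))\<^sup>2 = (cmod z)\<^sup>2 + (cmod \<beta>)\<^sup>2 + 2 * Re (z * cnj \<beta>)" for z
    unfolding cmod_power2 by (simp add: power2_eq_square algebra_simps)
  ultimately have "D = A + B + 2 * Re (s * (\<alpha> * cnj \<beta>))"
    by (simp only: A_def B_def D_def mult.assoc)
  then have D: "D = A + B + x - e * y"
    by (simp add: e x_def y_def algebra_simps)
  \<comment> \<open>The difference is a combination of the two relations e^2 = 3 and A B = x^2 +
    y^2.\<close>
  have "3 * (A\<^sup>2 + B\<^sup>2 + C\<^sup>2 + D\<^sup>2) - (A + B + C + D)\<^sup>2 =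
      2 * (e\<^sup>2 - 3) * y\<^sup>2 - 6 * (A * B - x\<^sup>2 - y\<^sup>2)"
    unfolding C D by (simp add: power2_eq_square algebra_simps)
  then show ?thesis using AB e(1) by simp
qed

theorem theorem4p8:
  fixes A :: "nat \<Rightarrow> complex option" and X :: "complex option"
  assumes "fundamental_tetrahedron (A ` {1..4})"
    and "X \<in> eis_field_hat"
    and "X \<notin> A ` {1..4}"
  shows "(\<Sum>i = 1..4. det_length X (A i) ^ 4) =
    (\<Sum>(i, j) \<in> {(i, j). 1 \<le> i \<and> i < j \<and> j \<le> 4}.
       (det_length X (A i))\<^sup>2 * (det_length X (A j))\<^sup>2)"
proof -
  obtain p q where X: "irreducible_frac p q" "X = frac_point p q"
    using eis_field_hat_irreducible[OF assms(2)] .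
  obtain s a b c d where s: "s \<in> {eis, cnj eis}"
    and abcd: "a \<in> eis_ints" "b \<in> eis_ints" "c \<in> eis_ints" "d \<in> eis_ints" "cmod (a * d - b * c) = 1"
    and V: "A ` {1..4} = (\<lambda>(p, q). frac_point (a * p + b * q) (c * p + d * q)) `
      {(0, 1), (1, 1), (s, 1), (1, 0)}"
    and card: "card (A ` {1..4}) = 4"
    using fundamental_tetrahedron_vertices[OF assms(1)] .
  define \<alpha> \<beta> where "\<alpha> = p * c - a * q" and "\<beta> = p * d - b * q"
  have "s \<in> eis_ints" using s by auto
  \<comment> \<open>The determinant of \<open>X\<close> with the image of (u, v) is linear in (u,
    v), with coefficients \<alpha> and \<beta>.\<close>
  have len: "det_length X (frac_point (a * u + b * v) (c * u + d * v)) = cmod (u * \<alpha> + v * \<beta>)"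
    if "irreducible_frac u v" for u v
    unfolding X(2) det_length_frac_point[OF X(1) irreducible_frac_unimodular[OF abcd that]]
    by (simp add: \<alpha>_def \<beta>_def algebra_simps)
  have len': "det_length X (frac_point b d) = cmod \<beta>"
    "det_length X (frac_point (a + b) (c + d)) = cmod (\<alpha> + \<beta>)"
    "det_length X (frac_point (a * s + b) (c * s + d)) = cmod (s * \<alpha> + \<beta>)"
    "det_length X (frac_point a c) = cmod \<alpha>"
    using len[of 0 1] len[of 1 1] len[of s 1] len[of 1 0] irreducible_frac_1 \<open>s \<in> eis_ints\<close> by auto
  define f where "f i = (det_length X (A i))\<^sup>2" for i
  \<comment> \<open>Four distinct vertices make \<open>A\<close> injective, so sums over indices
    become sums over the vertex set, whatever the labelling.\<close>
  have inj: "inj_on A {1..4}" using card by (intro eq_card_imp_inj_on) auto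
  have sum_f: "(\<Sum>i = 1..4. g (f i)) =
      g ((cmod \<alpha>)\<^sup>2) + g ((cmod \<beta>)\<^sup>2) + g ((cmod (\<alpha> + \<beta>))\<^sup>2) + g ((cmod (s * \<alpha> + \<beta>))\<^sup>2)"
    for g :: "real \<Rightarrow> real"
  proof -
    have V': "A ` {1..4} = {frac_point b d, frac_point (a + b) (c + d),
        frac_point (a * s + b) (c * s + d), frac_point a c}"
      unfolding V by (simp add: mult.commute)
    have "(\<Sum>i = 1..4. g (f i)) = (\<Sum>y \<in> A ` {1..4}. g ((det_length X y)\<^sup>2))"
      by (simp only: sum.reindex[OF inj] f_def o_def)
    also have "\<dots> = g ((cmod \<alpha>)\<^sup>2) + g ((cmod \<beta>)\<^sup>2) + g ((cmod (\<alpha> + \<beta>))\<^sup>2) + g ((cmod (s * \<alpha> + \<beta>))\<^sup>2)"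
      using card unfolding V' by (auto simp: card_insert_if len' split: if_splits)
    finally show ?thesis .
  qed
  \<comment> \<open>The general \<open>g\<close> is used for squaring and for the identity.
    Expanding the square on the right and cancelling leaves twice the claim.\<close>
  have "3 * (\<Sum>i = 1..4. (f i)\<^sup>2) = (\<Sum>i = 1..4. f i)\<^sup>2"
    using tetrahedron_identity[OF s] sum_f[of "\<lambda>x. x\<^sup>2"] sum_f[of "\<lambda>x. x"] by simp
  moreover have I: "{1..4} = {1, 2, 3, 4::nat}" by auto
  moreover have "{(i, j). 1 \<le> i \<and> i < j \<and> j \<le> (4::nat)} = {(1, 2), (1, 3), (1, 4), (2, 3), (2, 4), (3, 4)}"
    by auto
  moreover have "det_length X (A i) ^ 4 = (f i)\<^sup>2" for i
    by (simp add: f_def flip: power_mult)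
  ultimately show ?thesis
    unfolding f_def[symmetric] by (simp add: power2_eq_square algebra_simps)
qed

end
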